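(* There is at least one constructive example (an explicitly given function) representing each of the 28 unique distinct blocks $B_1,\dots,B_{28}$ of functions in $F(\mathbb{R},\mathbb{R})$; that is, for every pair of integers $1\le q\le p\le 7$ there is at least one constructive example of a function $f:\mathbb{R}\to\mathbb{R}$ such that $C_f$ has level $p$ and $D_f$ has level $q$.
   Context: $F(\mathbb{R},\mathbb{R})$ is the set of all functions $f:\mathbb{R}\to\mathbb{R}$. For such $f$, $C_f\subseteq\mathbb{R}$ is the set of points at which $f$ is continuous, $D_f\subseteq\mathbb{R}$ is the set of points at which $f$ is differentiable, and $A^c=\mathbb{R}\setminus A$. For $A\subseteq\mathbb{R}$ write $\mathrm{Card}(A)=0$ if $A$ is empty, $n$ if $A$ is non-empty and finite (all non-empty finite sets form one single category), $\aleph_0$ if $A$ is countably infinite, $c$ if $A$ is uncountable. A set $A\subseteq\mathbb{R}$ has level $1,2,3,4,5,6,7$ according as $(\mathrm{Card}(A),\mathrm{Card}(A^c))$ equals $(0,c),(n,c),(\aleph_0,c),(c,c),(c,\aleph_0),(c,n),(c,0)$, respectively. For $1\le q\le p\le 7$, the block with number $i=\frac{p(p-1)}{2}+q\in\{1,\dots,28\}$ is $B_i=\{f\in F(\mathbb{R},\mathbb{R}): C_f \text{ has level } p,\ D_f \text{ has level } q\}$. "Constructive" is used informally, meaning that the representative function of the block is exhibited explicitly rather than merely shown to exist. *)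

theory Defs
  imports Complex_Main "HOL-Library.Countable_Set"
begin

datatype cardinality = Card_0 | Card_n | Card_aleph0 | Card_c

text \<open>All non-empty finite sets share the value \<open>Card_n\<close>; following the classification
  being formalized, \<open>Card_c\<close> simply means "uncountable".\<close>

definition Card :: "real set \<Rightarrow> cardinality" where
  "Card A =
     (if A = {} then Card_0
      else if finite A then Card_n
      else if countable A then Card_aleph0
      else Card_c)"

definition has_level :: "real set \<Rightarrow> nat \<Rightarrow> bool" where
  "has_level A l \<longleftrightarrow>
     (l, Card A, Card (- A)) \<in>
       {(1, Card_0, Card_c),
        (2, Card_n, Card_c),
        (3, Card_aleph0, Card_c),
        (4, Card_c, Card_c),
        (5, Card_c, Card_aleph0),
        (6, Card_c, Card_n),
        (7, Card_c, Card_0)}"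

definition continuity_set :: "(real \<Rightarrow> real) \<Rightarrow> real set" where
  "continuity_set f = {x. isCont f x}"

definition differentiability_set :: "(real \<Rightarrow> real) \<Rightarrow> real set" where
  "differentiability_set f = {x. f differentiable (at x)}"

definition block_index :: "nat \<Rightarrow> nat \<Rightarrow> nat" where
  "block_index p q = p * (p - 1) div 2 + q"

definition block :: "nat \<Rightarrow> (real \<Rightarrow> real) set" where
  "block i = {f. \<exists>p q. 1 \<le> q \<and> q \<le> p \<and> p \<le> 7 \<and> i = block_index p q \<and>
                   has_level (continuity_set f) p \<and> has_level (differentiability_set f) q}"

text \<open>The explicit representatives. Being constructive is not a property of a function as an
  element of the function space, so it is rendered by naming the witnesses below by closed
  formulas, without any choice operator, instead of quantifying over them existentially.\<close>

definition dirichlet :: "real \<Rightarrow> real" where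
  "dirichlet x = (if x \<in> \<rat> then 1 else 0)"

text \<open>The Takagi (blancmange) function, continuous and nowhere differentiable; the numerators
  are the distances of \<open>2 ^ n * x\<close> to the nearest integer.\<close>

definition takagi :: "real \<Rightarrow> real" where
  "takagi x = (\<Sum>n. \<bar>2 ^ n * x - of_int (round (2 ^ n * x))\<bar> / 2 ^ n)"

text \<open>For \<open>p \<le> 3\<close>: a smooth factor of \<open>dirichlet\<close>. The product is continuous exactly at
  the zeros of the factor, and differentiable exactly at its multiple zeros.\<close>

definition smooth_factor :: "nat \<Rightarrow> nat \<Rightarrow> real \<Rightarrow> real" where
  "smooth_factor p q x =
     (if (p, q) = (1, 1) then 1
      else if (p, q) = (2, 1) then x
      else if (p, q) = (2, 2) then x ^ 2
      else if (p, q) = (3, 1) then sin (pi * x)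
      else if (p, q) = (3, 2) then x * sin (pi * x)
      else if (p, q) = (3, 3) then sin (pi * x) ^ 2
      else 0)"

text \<open>For \<open>p \<ge> 4\<close>: a part that is locally constant around each of its points of continuity,
  which form a set of level \<open>p\<close>, plus a continuous part whose points of differentiability form
  a set of level \<open>q\<close>.\<close>

definition jump_part :: "nat \<Rightarrow> real \<Rightarrow> real" where
  "jump_part p x =
     (if p = 4 then (if x > 0 then dirichlet x else 0)
      else if p = 5 then of_int \<lfloor>x\<rfloor>
      else if p = 6 then sgn x
      else 0)"

definition continuous_part :: "nat \<Rightarrow> real \<Rightarrow> real" where
  "continuous_part q x =
     (if q = 1 then takagi x
      else if q = 2 then (x + 1 / 2) * takagi x
      else if q = 3 then cos (pi * x) * takagi x
      else if q = 4 then max x 0 * takagi x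
      else if q = 5 then \<bar>sin (pi * x)\<bar>
      else if q = 6 then \<bar>x\<bar>
      else 0)"

definition representative :: "nat \<Rightarrow> nat \<Rightarrow> real \<Rightarrow> real" where
  "representative p q x =
     (if p \<le> 3 then smooth_factor p q x * dirichlet x
      else jump_part p x + continuous_part q x)"

end

theory Submission
  imports Defs "HOL-Analysis.Analysis"
begin

text \<open>
  A representative is built from ingredients whose sets of continuity and of differentiability
  points can be read off.

  If the continuity set is to be countable, the Dirichlet function is multiplied by a smooth
  function \<open>s\<close>. Rationals and irrationals both accumulate at every point, so a limit of
  \<open>g * dirichlet\<close> must equal both the limit of \<open>g\<close> and \<open>0\<close>
  (\<open>tendsto_times_dirichlet_iff\<close>). Used for \<open>g = s\<close>, this says that the product is continuous
  exactly at the zeros of \<open>s\<close>; used for the difference quotient of \<open>s\<close> at a zero, it says that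
  the product is differentiable exactly at the multiple zeros. The zero sets of \<open>x\<close> and
  \<open>sin (pi * x)\<close> and of their products supply the finite and the countably infinite levels.

  If the continuity set is to be uncountable, the representative is the sum of a part that is
  locally constant off the set \<open>jumps p\<close> and discontinuous on it, and of a continuous part that
  is differentiable exactly on \<open>smooth_points q\<close>. The first part then decides about continuity,
  and about differentiability it only removes the jumps, so that the two sets are \<open>- jumps p\<close>
  and \<open>smooth_points q - jumps p\<close> (\<open>representative_sets_ge_4\<close>).
  Here the small sets of differentiability points come from the Takagi function
  \<open>T\<close>: it is continuous and nowhere differentiable, so \<open>w * T\<close> with \<open>w\<close> differentiable is
  differentiable exactly at the zeros of \<open>w\<close> (\<open>differentiable_times_takagi_iff\<close>). The large ones
  come from absolute values, which have a kink at each simple zero (\<open>differentiable_abs_iff\<close>).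

  The Takagi function is nowhere differentiable because the amount by which its value at the
  midpoint of a dyadic interval exceeds the mean of its values at the endpoints is half the length
  of the interval (\<open>takagi_midpoint\<close>), whereas for a function differentiable at \<open>x\<close> this
  defect is of smaller order than the length, for intervals shrinking to \<open>x\<close>
  (\<open>differentiable_imp_midpoint_defect_small\<close>).

  Distinct block numbers give distinct blocks because a set has at most one level, so the blocks
  are disjoint, and because the representatives make all of them non-empty.
\<close>

section \<open>Levels\<close>

lemma has_level_unique: "has_level A l \<Longrightarrow> has_level A m \<Longrightarrow> l = m"
  by (auto simp: has_level_def)

text \<open>The numbering of the levels is symmetric under complementation, so only levels up to 4 need
  a direct count.\<close>
lemma has_level_compl:
  assumes "has_level A l"
  shows "has_level (- A) (8 - l)"
  using assms unfolding has_level_def double_complement by (elim insertE emptyE; simp)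

lemma uncountable_if_open_interval:
  fixes A :: "real set"
  assumes "{a<..<b} \<subseteq> A" "a < b"
  shows "uncountable A"
  using assms countable_subset uncountable_open_interval by blast

lemma Card_c_if_uncountable: "uncountable A \<Longrightarrow> Card A = Card_c"
  by (auto simp: Card_def countable_finite)

lemma Card_c_compl_if_countable:
  fixes A :: "real set"
  assumes "countable A"
  shows "Card (- A) = Card_c"
  using uncountable_minus_countable[OF uncountable_UNIV_real assms]
  by (intro Card_c_if_uncountable) (simp add: Compl_eq_Diff_UNIV)

lemma has_level_1: "has_level {} 1"
  using Card_c_compl_if_countable[of "{}"] by (simp add: has_level_def Card_def)

lemma has_level_2:
  assumes "finite A" "A \<noteq> {}"
  shows "has_level A 2"
  using assms Card_c_compl_if_countable[of A] by (simp add: has_level_def Card_def countable_finite)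

lemma has_level_3:
  assumes "countable A" "infinite A"
  shows "has_level A 3"
  using assms Card_c_compl_if_countable[of A] by (auto simp: has_level_def Card_def)

lemma has_level_4:
  assumes "uncountable A" "uncountable (- A)"
  shows "has_level A 4"
  using assms by (simp add: has_level_def Card_c_if_uncountable)

lemma countable_Ints: "countable (\<int> :: real set)"
  by (simp add: Ints_def)

lemma infinite_Ints: "infinite (\<int> :: real set)"
proof
  have "inj (of_int :: int \<Rightarrow> real)" by (rule injI) (simp only: of_int_eq_iff)
  moreover assume "finite (\<int> :: real set)"
  ultimately have "finite (UNIV :: int set)" unfolding Ints_def by (rule finite_imageD[rotated])
  then show False by (simp add: infinite_UNIV_int)
qed

section \<open>Limits of products with the Dirichlet function\<close>

lemma irrational_dense:
  fixes a b :: real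
  assumes "a < b"
  shows "\<exists>s\<in>-\<rat>. a < s \<and> s < b"
proof -
  have "uncountable ({a<..<b} - \<rat>)"
    using assms by (intro uncountable_minus_countable) (auto simp: uncountable_open_interval countable_rat)
  then have "{a<..<b} - \<rat> \<noteq> {}" by (metis countable_empty)
  then show ?thesis by auto
qed

lemma at_within_dense_neq_bot:
  fixes S :: "real set"
  assumes dense: "\<And>a b. a < b \<Longrightarrow> \<exists>s\<in>S. a < s \<and> s < b"
  shows "at x within S \<noteq> bot"
proof -
  have "x islimpt S"
    unfolding islimpt_approachable
  proof (intro allI impI)
    fix e :: real assume "0 < e"
    then obtain s where "s \<in> S" "x < s" "s < x + e" using dense[of x "x + e"] by auto
    then show "\<exists>s\<in>S. s \<noteq> x \<and> dist s x < e" by (intro bexI[of _ s]) (auto simp: dist_real_def)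
  qed
  then show ?thesis by (simp add: trivial_limit_within)
qed

text \<open>Along the irrationals the product vanishes, along the rationals it agrees with \<open>g\<close>; both
  restricted filters are proper, so both values are the limit \<open>L\<close>. Conversely, a factor tending to
  \<open>0\<close> absorbs the bounded Dirichlet function.\<close>
lemma tendsto_times_dirichlet_iff:
  fixes g :: "real \<Rightarrow> real"
  assumes g: "(g \<longlongrightarrow> D) (at a)"
  shows "((\<lambda>y. g y * dirichlet y) \<longlongrightarrow> L) (at a) \<longleftrightarrow> D = 0 \<and> L = 0"
proof
  assume lim: "((\<lambda>y. g y * dirichlet y) \<longlongrightarrow> L) (at a)"
  have Q: "at a within \<rat> \<noteq> bot" and I: "at a within -\<rat> \<noteq> bot"
    using Rats_dense_in_real irrational_dense by (intro at_within_dense_neq_bot; blast)+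
  have on: "((\<lambda>y. g y * dirichlet y) \<longlongrightarrow> L) (at a within S)" for S
    using lim by (rule tendsto_within_subset) simp
  have "((\<lambda>y. g y * dirichlet y) \<longlongrightarrow> 0) (at a within -\<rat>)"
    by (rule tendsto_eventually) (auto simp: eventually_at_filter dirichlet_def)
  then have "L = 0" using on I tendsto_unique by blast
  have "(g \<longlongrightarrow> D) (at a within \<rat>)" using g by (rule tendsto_within_subset) simp
  then have "((\<lambda>y. g y * dirichlet y) \<longlongrightarrow> D) (at a within \<rat>)"
    by (rule Lim_transform_eventually) (auto simp: eventually_at_filter dirichlet_def)
  then have "L = D" using on Q tendsto_unique by blast
  with \<open>L = 0\<close> show "D = 0 \<and> L = 0" by simp
next
  assume "D = 0 \<and> L = 0"
  then have "(g \<longlongrightarrow> 0) (at a)" "L = 0" using g by auto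
  moreover have "((\<lambda>y. g y * dirichlet y) \<longlongrightarrow> 0) (at a)" if "(g \<longlongrightarrow> 0) (at a)"
    by (rule Lim_null_comparison[OF _ tendsto_rabs_zero[OF that]]) (auto simp: dirichlet_def)
  ultimately show "((\<lambda>y. g y * dirichlet y) \<longlongrightarrow> L) (at a)" by simp
qed

lemma isCont_times_dirichlet_iff:
  assumes "isCont s a"
  shows "isCont (\<lambda>x. s x * dirichlet x) a \<longleftrightarrow> s a = 0"
  using tendsto_times_dirichlet_iff[of s "s a" a "s a * dirichlet a"] assms
  by (auto simp: isCont_def)

text \<open>Off the zeros of \<open>s\<close> the product is not even continuous. At a zero its difference quotient is
  that of \<open>s\<close> times the Dirichlet function, whose limit behaviour is known.\<close>
lemma differentiable_times_dirichlet_iff: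
  assumes s: "(s has_real_derivative D) (at a)"
  shows "(\<lambda>x. s x * dirichlet x) differentiable (at a) \<longleftrightarrow> s a = 0 \<and> D = 0"
proof (cases "s a = 0")
  case True
  have "((\<lambda>y. s y / (y - a)) \<longlongrightarrow> D) (at a)"
    using s True by (simp add: has_field_derivative_iff)
  note lim = tendsto_times_dirichlet_iff[OF this]
  have "((\<lambda>x. s x * dirichlet x) has_real_derivative L) (at a) \<longleftrightarrow> D = 0 \<and> L = 0" for L
    unfolding has_field_derivative_iff lim[symmetric] using True by simp
  then show ?thesis using True by (auto simp: real_differentiable_def)
next
  case False
  have "isCont s a" using s by (rule DERIV_isCont)
  then have "\<not> isCont (\<lambda>x. s x * dirichlet x) a" using False isCont_times_dirichlet_iff by blast
  then show ?thesis using False differentiable_imp_continuous_within by blast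
qed

section \<open>The Takagi function\<close>

definition int_dist :: "real \<Rightarrow> real" where
  "int_dist x = \<bar>x - of_int (round x)\<bar>"

lemma int_dist_le: "int_dist x \<le> \<bar>x - of_int m\<bar>"
  unfolding int_dist_def by (rule round_diff_minimal)

lemma int_dist_of_int [simp]: "int_dist (of_int k) = 0"
  by (simp add: int_dist_def)

lemma int_dist_bounds: "0 \<le> int_dist x" "int_dist x \<le> 1"
  using of_int_round_abs_le[of x] unfolding int_dist_def by linarith+

lemma int_dist_eq:
  assumes "\<bar>x - of_int m\<bar> \<le> 1 / 2"
  shows "int_dist x = \<bar>x - of_int m\<bar>"
proof (cases "round x = m")
  case True
  then show ?thesis by (simp add: int_dist_def)
next
  case False
  then have "round x + 1 \<le> m \<or> m + 1 \<le> round x" by linarith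
  then have "of_int (round x) + 1 \<le> (of_int m :: real) \<or> of_int m + 1 \<le> (of_int (round x) :: real)"
    by linarith
  then have "1 / 2 \<le> int_dist x" using assms unfolding int_dist_def by linarith
  then show ?thesis using int_dist_le[of x m] assms by linarith
qed

lemma int_dist_Lipschitz: "int_dist x \<le> int_dist y + \<bar>x - y\<bar>"
  using int_dist_le[of x "round y"] unfolding int_dist_def by linarith

lemma isCont_int_dist: "isCont int_dist x"
proof -
  have "\<bar>int_dist y - int_dist x\<bar> \<le> \<bar>y - x\<bar>" for y
    using int_dist_Lipschitz[of x y] int_dist_Lipschitz[of y x] by linarith
  then have "((\<lambda>y. int_dist y - int_dist x) \<longlongrightarrow> 0) (at x)"
    by (intro Lim_null_comparison[OF _ tendsto_rabs_zero[OF LIM_zero[OF tendsto_ident_at]]]) auto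
  then show ?thesis by (simp add: isCont_def LIM_zero_iff)
qed

text \<open>The assumptions place \<open>a\<close> and \<open>b\<close> in one interval between consecutive half-integers, where
  the distance to the nearest integer is affine.\<close>
lemma int_dist_midpoint:
  assumes "of_int c \<le> 2 * a" "a \<le> b" "2 * b \<le> of_int c + 1"
  shows "int_dist ((a + b) / 2) = (int_dist a + int_dist b) / 2"
proof (cases "even c")
  case True
  then obtain m where "c = 2 * m" by auto
  then have m: "of_int c = 2 * (of_int m :: real)" by simp
  have "int_dist y = y - of_int m" if "a \<le> y" "y \<le> b" for y
    using int_dist_eq[of y m] that assms m by linarith
  from this[of a] this[of b] this[of "(a + b) / 2"] show ?thesis
    using assms by argo
next
  case False
  then obtain k where "c = 2 * k + 1" by (auto elim: oddE)
  moreover define m where "m = k + 1"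
  ultimately have m: "of_int c = 2 * (of_int m :: real) - 1" by simp
  have "int_dist y = of_int m - y" if "a \<le> y" "y \<le> b" for y
    using int_dist_eq[of y m] that assms m by linarith
  from this[of a] this[of b] this[of "(a + b) / 2"] show ?thesis
    using assms by argo
qed

lemma takagi_eq: "takagi x = (\<Sum>n. int_dist (2 ^ n * x) / 2 ^ n)"
  by (simp add: takagi_def int_dist_def)

lemma takagi_term_le: "norm (int_dist (2 ^ n * x) / 2 ^ n) \<le> (1 / 2) ^ n"
  using int_dist_bounds[of "2 ^ n * x"] by (simp add: power_divide field_simps)

lemma summable_takagi: "summable (\<lambda>n. int_dist (2 ^ n * x) / 2 ^ n)"
  by (rule summable_comparison_test'[OF summable_geometric takagi_term_le]) simp

text \<open>The functional equation replaces term-by-term work with the series: a statement about dyadic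
  intervals of length \<open>1 / 2 ^ Suc n\<close> becomes one about intervals of length \<open>1 / 2 ^ n\<close>.\<close>
lemma takagi_rec: "takagi x = int_dist x + takagi (2 * x) / 2"
proof -
  have "takagi x = int_dist x + (\<Sum>n. int_dist (2 ^ Suc n * x) / 2 ^ Suc n)"
    unfolding takagi_eq using suminf_split_head[OF summable_takagi[of x]] by simp
  also have "(\<Sum>n. int_dist (2 ^ Suc n * x) / 2 ^ Suc n)
      = (\<Sum>n. int_dist (2 ^ n * (2 * x)) / 2 ^ n / 2)"
    by (simp add: algebra_simps)
  also have "\<dots> = takagi (2 * x) / 2"
    unfolding takagi_eq by (rule suminf_divide[OF summable_takagi])
  finally show ?thesis .
qed

lemma takagi_of_int: "takagi (of_int k) = 0"
proof -
  have "int_dist (2 ^ n * of_int k) = 0" for n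
    using int_dist_of_int[of "2 ^ n * k"] by simp
  then show ?thesis by (simp add: takagi_eq)
qed

lemma isCont_takagi: "isCont takagi x"
proof -
  have "continuous_on UNIV (\<lambda>x. \<Sum>n. int_dist (2 ^ n * x) / 2 ^ n)"
  proof (rule uniform_limit_theorem)
    show "uniform_limit UNIV (\<lambda>n x. \<Sum>i<n. int_dist (2 ^ i * x) / 2 ^ i)
            (\<lambda>x. \<Sum>n. int_dist (2 ^ n * x) / 2 ^ n) sequentially"
      by (rule Weierstrass_m_test[OF takagi_term_le]) (simp add: summable_geometric)
    have "isCont (\<lambda>x. \<Sum>i<n. int_dist (2 ^ i * x) / 2 ^ i) x" for n x
      by (intro continuous_intros isCont_o2[OF _ isCont_int_dist]) auto
    then show "\<forall>\<^sub>F n in sequentially. continuous_on UNIV (\<lambda>x. \<Sum>i<n. int_dist (2 ^ i * x) / 2 ^ i)"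
      by (simp add: continuous_at_imp_continuous_on)
  qed simp
  then show ?thesis by (simp add: continuous_on_eq_continuous_at takagi_eq[abs_def])
qed

text \<open>In the functional equation the first term is affine on dyadic intervals of length at most
  \<open>1 / 2\<close>, so it contributes nothing to the midpoint defect, and the second one halves the defect of
  the interval of twice the length. The induction starts at unit intervals, where only the value
  \<open>1 / 2\<close> of the first term at the midpoint counts.\<close>
lemma takagi_midpoint:
  "takagi ((of_int j / 2 ^ n + (of_int j + 1) / 2 ^ n) / 2)
    = (takagi (of_int j / 2 ^ n) + takagi ((of_int j + 1) / 2 ^ n)) / 2 + 1 / 2 / 2 ^ n"
proof (induction n)
  case 0
  let ?m = "(of_int j + (of_int j + 1)) / 2 :: real"
  have "?m - of_int j = 1 / 2" by argo
  then have "int_dist ?m = 1 / 2" using int_dist_eq[of ?m j] by simp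
  moreover have "2 * ?m = of_int (j + (j + 1))" by simp
  then have "takagi (2 * ?m) = 0" by (simp only: takagi_of_int)
  ultimately have "takagi ?m = 1 / 2" using takagi_rec[of ?m] by simp
  then show ?case using takagi_of_int[of j] takagi_of_int[of "j + 1"] by simp
next
  case (Suc n)
  let ?a = "of_int j / 2 ^ Suc n :: real" and ?b = "(of_int j + 1) / 2 ^ Suc n :: real"
  \<comment> \<open>Doubling the interval puts it between the consecutive integers \<open>?c\<close> and \<open>?c + 1\<close>.\<close>
  let ?c = "j div 2 ^ n"
  have d: "2 * ?a = of_int j / 2 ^ n" "2 * ?b = (of_int j + 1) / 2 ^ n"
    "2 * ((?a + ?b) / 2) = (of_int j / 2 ^ n + (of_int j + 1) / 2 ^ n) / 2"
    by (simp_all add: field_simps)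
  have "?c * 2 ^ n + j mod 2 ^ n = j" by (rule div_mult_mod_eq)
  moreover have "0 \<le> j mod 2 ^ n" "j mod 2 ^ n < 2 ^ n" by simp_all
  moreover have "(?c + 1) * 2 ^ n = ?c * 2 ^ n + 2 ^ n" by (simp add: distrib_right)
  ultimately have j: "?c * 2 ^ n \<le> j" "j + 1 \<le> (?c + 1) * 2 ^ n" by linarith+
  have "of_int (?c * 2 ^ n) \<le> (of_int j :: real)" using j(1) by (simp only: of_int_le_iff)
  then have "of_int ?c \<le> of_int j / (2 ^ n :: real)" by (simp add: field_simps)
  moreover have "of_int (j + 1) \<le> (of_int ((?c + 1) * 2 ^ n) :: real)"
    using j(2) by (simp only: of_int_le_iff)
  then have "(of_int j + 1) / 2 ^ n \<le> (of_int ?c + 1 :: real)" by (simp add: field_simps)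
  ultimately have mid: "int_dist ((?a + ?b) / 2) = (int_dist ?a + int_dist ?b) / 2"
    by (intro int_dist_midpoint[of ?c]) (simp_all only: d, simp add: divide_right_mono)
  have half: "1 / 2 / 2 ^ Suc n = 1 / 2 / 2 ^ n / (2 :: real)" by simp
  have average: "(x + y) / 2 + ((z + w) / 2 + h) / 2 = (x + z / 2 + (y + w / 2)) / 2 + h / 2"
    for x y z w h :: real by (simp add: field_simps)
  show ?case
    unfolding takagi_rec[of ?a] takagi_rec[of ?b] takagi_rec[of "(?a + ?b) / 2"] d Suc mid half
    by (rule average)
qed

text \<open>The midpoint defect of an affine function is \<open>0\<close>, so only the remainder \<open>r\<close> of the
  first-order expansion contributes, and it is small at all three points involved.\<close>
lemma differentiable_imp_midpoint_defect_small:
  fixes f :: "real \<Rightarrow> real"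
  assumes "f differentiable (at x)" "0 < e"
  shows "\<exists>d>0. \<forall>a b. a \<le> x \<and> x \<le> b \<and> b - a < d \<longrightarrow>
           \<bar>f ((a + b) / 2) - (f a + f b) / 2\<bar> \<le> e * (b - a)"
proof -
  obtain D where "(f has_derivative (\<lambda>h. h * D)) (at x)"
    using assms(1) by (auto simp: real_differentiable_def has_field_derivative_def mult_commute_abs)
  then obtain d where "d > 0"
    and d: "\<And>y. norm (y - x) < d \<Longrightarrow> norm (f y - f x - (y - x) * D) \<le> e / 2 * norm (y - x)"
    using assms(2) unfolding has_derivative_at_alt by (metis half_gt_zero)
  define r where "r y = f y - f x - (y - x) * D" for y
  have "\<bar>f ((a + b) / 2) - (f a + f b) / 2\<bar> \<le> e * (b - a)"
    if ab: "a \<le> x" "x \<le> b" "b - a < d" for a b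
  proof -
    have r: "\<bar>r y\<bar> \<le> e / 2 * (b - a)" if "a \<le> y" "y \<le> b" for y
    proof -
      have "\<bar>r y\<bar> \<le> e / 2 * \<bar>y - x\<bar>" using d[of y] that ab by (simp add: r_def)
      also have "\<dots> \<le> e / 2 * (b - a)" using that ab assms(2) by (intro mult_left_mono) auto
      finally show ?thesis .
    qed
    define E where "E = e / 2 * (b - a)"
    have E: "e * (b - a) = 2 * E" by (simp add: E_def)
    have "f ((a + b) / 2) - (f a + f b) / 2 = r ((a + b) / 2) - (r a + r b) / 2"
      unfolding r_def by (simp add: field_simps)
    moreover have "\<bar>u - (v + w) / 2\<bar> \<le> 2 * E" if "\<bar>u\<bar> \<le> E" "\<bar>v\<bar> \<le> E" "\<bar>w\<bar> \<le> E" for u v w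
      using that unfolding add_divide_distrib by linarith
    moreover have "\<bar>r a\<bar> \<le> E" "\<bar>r b\<bar> \<le> E" "\<bar>r ((a + b) / 2)\<bar> \<le> E"
      unfolding E_def by (rule r; use ab in simp)+
    ultimately show ?thesis unfolding E by metis
  qed
  then show ?thesis using \<open>d > 0\<close> by blast
qed

text \<open>On the dyadic intervals containing \<open>x\<close> the defect is half the length, which exceeds the
  quarter allowed by differentiability.\<close>
lemma takagi_not_differentiable: "\<not> takagi differentiable (at x)"
proof
  assume "takagi differentiable (at x)"
  then obtain d where "d > 0"
    and d: "\<And>a b. a \<le> x \<Longrightarrow> x \<le> b \<Longrightarrow> b - a < d \<Longrightarrow>
      \<bar>takagi ((a + b) / 2) - (takagi a + takagi b) / 2\<bar> \<le> 1 / 4 * (b - a)"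
    using differentiable_imp_midpoint_defect_small[of takagi x "1 / 4"] by auto
  obtain n where n: "(1 / 2) ^ n < d"
    using \<open>d > 0\<close> real_arch_pow_inv[of d "1 / 2"] by auto
  let ?j = "\<lfloor>2 ^ n * x\<rfloor>"
  have "of_int ?j / 2 ^ n \<le> x" "x \<le> (of_int ?j + 1) / 2 ^ n"
    using floor_correct[of "2 ^ n * x"] by (simp_all add: field_simps)
  moreover have "(of_int ?j + 1) / 2 ^ n - of_int ?j / 2 ^ n = (1 / 2 :: real) ^ n"
    by (simp add: field_simps power_divide)
  ultimately have "1 / 2 / 2 ^ n \<le> (1 / 4 :: real) * (1 / 2) ^ n"
    using d[of "of_int ?j / 2 ^ n" "(of_int ?j + 1) / 2 ^ n"] n takagi_midpoint[of ?j n] by simp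
  moreover have "(1 / 2 :: real) ^ n > 0" by simp
  ultimately show False by (simp add: power_divide field_simps)
qed

text \<open>Where \<open>w\<close> does not vanish, dividing by it would make the Takagi function differentiable. At a
  zero of \<open>w\<close> the difference quotient is that of \<open>w\<close> times a continuous function.\<close>
lemma differentiable_times_takagi_iff:
  assumes w: "(w has_real_derivative D) (at a)"
  shows "(\<lambda>x. w x * takagi x) differentiable (at a) \<longleftrightarrow> w a = 0"
proof
  assume "w a = 0"
  then have "((\<lambda>y. w y / (y - a)) \<longlongrightarrow> D) (at a)" using w by (simp add: has_field_derivative_iff)
  then have "((\<lambda>y. w y / (y - a) * takagi y) \<longlongrightarrow> D * takagi a) (at a)"
    using isCont_takagi[of a] by (intro tendsto_mult) (simp_all add: isCont_def)
  then have "((\<lambda>x. w x * takagi x) has_real_derivative D * takagi a) (at a)"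
    using \<open>w a = 0\<close> by (simp add: has_field_derivative_iff)
  then show "(\<lambda>x. w x * takagi x) differentiable (at a)" by (auto simp: real_differentiable_def)
next
  assume prod: "(\<lambda>x. w x * takagi x) differentiable (at a)"
  show "w a = 0"
  proof (rule ccontr)
    assume "w a \<noteq> 0"
    have "(w \<longlongrightarrow> w a) (nhds a)"
      using DERIV_isCont[OF w] by (simp add: tendsto_nhds_iff isCont_def)
    then have "\<forall>\<^sub>F y in nhds a. w y \<noteq> 0"
      using \<open>w a \<noteq> 0\<close> by (rule tendsto_imp_eventually_ne)
    then have ev: "\<forall>\<^sub>F y in nhds a. w y * takagi y / w y = takagi y"
      by eventually_elim simp
    obtain E where "((\<lambda>y. w y * takagi y / w y) has_real_derivative E) (at a)"
      using prod w \<open>w a \<noteq> 0\<close> by (auto simp: real_differentiable_def dest: DERIV_divide)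
    then have "(takagi has_real_derivative E) (at a)"
      using DERIV_cong_ev[OF refl ev refl] by blast
    then show False using takagi_not_differentiable by (auto simp: real_differentiable_def)
  qed
qed

section \<open>Kinks and jumps\<close>

text \<open>At a zero of \<open>s\<close> the absolute value has a minimum, so its derivative can only be \<open>0\<close>; the
  difference quotients of \<open>s\<close> and of its absolute value agree up to sign, hence both tend to \<open>0\<close>
  or neither does.\<close>
lemma differentiable_abs_iff:
  fixes s :: "real \<Rightarrow> real"
  assumes s: "(s has_real_derivative D) (at a)"
  shows "(\<lambda>x. \<bar>s x\<bar>) differentiable (at a) \<longleftrightarrow> s a \<noteq> 0 \<or> D = 0"
proof (cases "s a = 0")
  case True
  have lim: "((\<lambda>y. s y / (y - a)) \<longlongrightarrow> D) (at a)"
    using s True by (simp add: has_field_derivative_iff)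
  show ?thesis
  proof
    assume "(\<lambda>x. \<bar>s x\<bar>) differentiable (at a)"
    then obtain L where L: "((\<lambda>x. \<bar>s x\<bar>) has_real_derivative L) (at a)"
      by (auto simp: real_differentiable_def)
    then have "L = 0" by (rule DERIV_local_min[of _ _ _ 1]) (use True in auto)
    then have "((\<lambda>y. \<bar>s y\<bar> / (y - a)) \<longlongrightarrow> 0) (at a)"
      using L True by (simp add: has_field_derivative_iff)
    then have "((\<lambda>y. \<bar>\<bar>s y\<bar> / (y - a)\<bar>) \<longlongrightarrow> 0) (at a)" by (rule tendsto_rabs_zero)
    then have "((\<lambda>y. \<bar>s y / (y - a)\<bar>) \<longlongrightarrow> 0) (at a)" by simp
    then have "((\<lambda>y. s y / (y - a)) \<longlongrightarrow> 0) (at a)" by (rule tendsto_rabs_zero_cancel)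
    then show "s a \<noteq> 0 \<or> D = 0" using lim tendsto_unique trivial_limit_at by blast
  next
    assume "s a \<noteq> 0 \<or> D = 0"
    then have "((\<lambda>y. s y / (y - a)) \<longlongrightarrow> 0) (at a)" using True lim by simp
    then have "((\<lambda>y. \<bar>s y / (y - a)\<bar>) \<longlongrightarrow> 0) (at a)" by (rule tendsto_rabs_zero)
    then have "((\<lambda>y. \<bar>s y\<bar> / (y - a)) \<longlongrightarrow> 0) (at a)"
      by (intro tendsto_rabs_zero_cancel[of "\<lambda>y. \<bar>s y\<bar> / (y - a)"]) simp
    then have "((\<lambda>x. \<bar>s x\<bar>) has_real_derivative 0) (at a)"
      using True by (simp add: has_field_derivative_iff)
    then show "(\<lambda>x. \<bar>s x\<bar>) differentiable (at a)" by (auto simp: real_differentiable_def)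
  qed
next
  case False
  \<comment> \<open>The absolute value is the square root of the square, and the square is positive at \<open>a\<close>.\<close>
  have "0 < s a ^ 2" using False by simp
  from DERIV_chain2[OF DERIV_real_sqrt[OF this] DERIV_power[OF s, of 2]] show ?thesis
    using False by (auto simp: real_differentiable_def)
qed

lemma isCont_eps_delta:
  fixes f :: "real \<Rightarrow> real"
  assumes "isCont f x" "0 < e"
  obtains d where "0 < d" "\<And>y. \<bar>y - x\<bar> < d \<Longrightarrow> \<bar>f y - f x\<bar> < e"
  using assms unfolding continuous_at_eps_delta dist_real_def by blast

definition jumps :: "nat \<Rightarrow> real set" where
  "jumps p = (if p = 4 then {0..} else if p = 5 then \<int> else if p = 6 then {0} else {})"

lemma jump_part_discontinuous:
  assumes "x \<in> jumps p"
  shows "\<not> isCont (jump_part p) x"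
proof
  assume "isCont (jump_part p) x"
  then obtain d where "0 < d"
    and d: "\<And>y. \<bar>y - x\<bar> < d \<Longrightarrow> \<bar>jump_part p y - jump_part p x\<bar> < 1 / 2"
    by (rule isCont_eps_delta[of _ _ "1 / 2"]) auto
  consider "p = 4" "0 \<le> x" | "p = 5" "x \<in> \<int>" | "p = 6" "x = 0"
    using assms by (auto simp: jumps_def split: if_splits)
  then show False
  proof cases
    case 1
    \<comment> \<open>The values \<open>1\<close> and \<open>0\<close> are both taken just to the right of \<open>x\<close>, and no number is at
      distance less than \<open>1 / 2\<close> from both.\<close>
    obtain r where "r \<in> \<rat>" "x < r" "r < x + d"
      using Rats_dense_in_real[of x "x + d"] \<open>0 < d\<close> by auto
    moreover obtain s where "s \<notin> \<rat>" "x < s" "s < x + d"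
      using irrational_dense[of x "x + d"] \<open>0 < d\<close> by auto
    ultimately show False
      using d[of r] d[of s] 1 by (simp add: jump_part_def dirichlet_def)
  next
    case 2
    then obtain k where "x = of_int k" by (auto elim: Ints_cases)
    then have "\<lfloor>x - d / 2\<rfloor> \<le> k - 1" "\<lfloor>x\<rfloor> = k" using \<open>0 < d\<close> by (simp_all, linarith)
    then have "(of_int \<lfloor>x - d / 2\<rfloor> :: real) \<le> of_int \<lfloor>x\<rfloor> - 1" by linarith
    then show False using d[of "x - d / 2"] \<open>0 < d\<close> 2 by (simp add: jump_part_def)
  next
    case 3
    then show False using d[of "d / 2"] \<open>0 < d\<close> by (simp add: jump_part_def)
  qed
qed

lemma has_real_derivative_locally_constant:
  fixes f :: "real \<Rightarrow> real"
  assumes "open S" "x \<in> S" "\<And>y. y \<in> S \<Longrightarrow> f y = c"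
  shows "(f has_real_derivative 0) (at x)"
  by (rule has_field_derivative_transform_within_open[OF DERIV_const[of c] assms(1,2)])
    (simp add: assms(3))

lemma jump_part_derivative:
  assumes "x \<notin> jumps p"
  shows "(jump_part p has_real_derivative 0) (at x)"
proof -
  consider "p = 4" "x < 0" | "p = 5" "x \<notin> \<int>" | "p = 6" "x < 0" | "p = 6" "0 < x"
    | "p \<notin> {4, 5, 6}"
    using assms by (auto simp: jumps_def split: if_splits) (metis less_linear)
  then show ?thesis
  proof cases
    case 1
    then show ?thesis
      by (intro has_real_derivative_locally_constant[of "{..<0}" _ _ 0]) (auto simp: jump_part_def)
  next
    case 2
    then have "of_int \<lfloor>x\<rfloor> \<noteq> x" by (metis Ints_of_int)
    then have "of_int \<lfloor>x\<rfloor> < x" "x < of_int \<lfloor>x\<rfloor> + 1" by linarith+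
    then have "x \<in> {of_int \<lfloor>x\<rfloor><..<of_int \<lfloor>x\<rfloor> + 1}" by simp
    moreover have "\<lfloor>y\<rfloor> = \<lfloor>x\<rfloor>" if "y \<in> {of_int \<lfloor>x\<rfloor><..<of_int \<lfloor>x\<rfloor> + 1}" for y
      using that by (intro floor_unique) auto
    ultimately show ?thesis using 2
      by (intro has_real_derivative_locally_constant[of "{of_int \<lfloor>x\<rfloor><..<of_int \<lfloor>x\<rfloor> + 1}" _ _
            "of_int \<lfloor>x\<rfloor>"]) (auto simp: jump_part_def)
  next
    case 3
    then show ?thesis
      by (intro has_real_derivative_locally_constant[of "{..<0}" _ _ "-1"]) (auto simp: jump_part_def)
  next
    case 4
    then show ?thesis
      by (intro has_real_derivative_locally_constant[of "{0<..}" _ _ 1]) (auto simp: jump_part_def)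
  next
    case 5
    then show ?thesis
      by (intro has_real_derivative_locally_constant[of UNIV _ _ 0]) (auto simp: jump_part_def)
  qed
qed

section \<open>Continuous functions with a prescribed set of differentiability points\<close>

lemma isCont_continuous_part: "isCont (continuous_part q) x"
proof -
  consider "q = 1" | "q = 2" | "q = 3" | "q = 4" | "q = 5" | "q = 6" | "q \<notin> {1, 2, 3, 4, 5, 6}"
    by blast
  then have "continuous_part q \<in> {takagi, \<lambda>x. (x + 1 / 2) * takagi x, \<lambda>x. cos (pi * x) * takagi x,
    \<lambda>x. max x 0 * takagi x, \<lambda>x. \<bar>sin (pi * x)\<bar>, \<lambda>x. \<bar>x\<bar>, \<lambda>x. 0}"
    by cases (simp_all add: continuous_part_def[abs_def])
  then show ?thesis
    by (elim insertE emptyE; simp only:) (intro continuous_intros isCont_takagi)+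
qed

definition smooth_points :: "nat \<Rightarrow> real set" where
  "smooth_points q =
     (if q = 1 then {}
      else if q = 2 then {- 1 / 2}
      else if q = 3 then range (\<lambda>k::int. of_int k + 1 / 2)
      else if q = 4 then {..0}
      else if q = 5 then - \<int>
      else if q = 6 then - {0}
      else UNIV)"

lemma cos_pi_times_eq_0_iff: "cos (pi * x) = 0 \<longleftrightarrow> x \<in> range (\<lambda>k::int. of_int k + 1 / 2)"
proof -
  have "pi * x = of_int k * pi + pi / 2 \<longleftrightarrow> x = of_int k + 1 / 2" for k
  proof -
    have "of_int k * pi + pi / 2 = pi * (of_int k + 1 / 2)" by (simp add: algebra_simps)
    then show ?thesis by (metis mult_left_cancel pi_neq_zero)
  qed
  then show ?thesis by (auto simp: cos_zero_iff_int2)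
qed

lemma sin_pi_times_eq_0_iff: "sin (pi * x) = 0 \<longleftrightarrow> x \<in> \<int>"
  using sin_times_pi_eq_0[of x] by (simp add: mult.commute)

lemma has_real_derivative_sin_pi: "((\<lambda>x. sin (pi * x)) has_real_derivative pi * cos (pi * x)) (at x)"
  by (auto intro!: derivative_eq_intros)

lemma cos_pi_times_neq_0: "x \<in> \<int> \<Longrightarrow> cos (pi * x) \<noteq> 0"
  using sin_pi_times_eq_0_iff[of x] sin_zero_abs_cos_one[of "pi * x"] by auto

text \<open>The factor has a kink at \<open>0\<close>, so the criterion for differentiable factors does not apply
  there. The product is differentiable at \<open>0\<close> nevertheless, because \<open>max y 0 / y\<close> is bounded and
  the Takagi function vanishes at \<open>0\<close>.\<close>
lemma positive_part_times_takagi_differentiable_iff: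
  "(\<lambda>x. max x 0 * takagi x) differentiable (at a) \<longleftrightarrow> a \<le> 0"
proof -
  consider "a < 0" | "a = 0" | "0 < a" by linarith
  then show ?thesis
  proof cases
    case 1
    then have "((\<lambda>x. max x 0) has_real_derivative 0) (at a)"
      by (intro has_real_derivative_locally_constant[of "{..<0}" _ _ 0]) auto
    then show ?thesis using differentiable_times_takagi_iff 1 by fastforce
  next
    case 2
    have "takagi 0 = 0" using takagi_of_int[of 0] by simp
    then have "(takagi \<longlongrightarrow> 0) (at 0)" using isCont_takagi[of 0] by (simp add: isCont_def)
    then have lim: "((\<lambda>y. \<bar>takagi y\<bar>) \<longlongrightarrow> 0) (at 0)" by (rule tendsto_rabs_zero)
    have quotient: "max y 0 * takagi y / y = (if 0 < y then takagi y else 0)" for y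
      by (simp add: max_def)
    have "((\<lambda>y. max y 0 * takagi y / y) \<longlongrightarrow> 0) (at 0)"
      by (rule Lim_null_comparison[OF _ lim]) (simp add: quotient)
    then have "((\<lambda>x. max x 0 * takagi x) has_real_derivative 0) (at 0)"
      by (simp add: has_field_derivative_iff)
    then show ?thesis using 2 by (auto simp: real_differentiable_def)
  next
    case 3
    then have "((\<lambda>x. max x 0) has_real_derivative 1) (at a)"
      by (intro has_field_derivative_transform_within_open[OF DERIV_ident, of "{0<..}"]) auto
    then show ?thesis using differentiable_times_takagi_iff 3 by fastforce
  qed
qed

lemma continuous_part_differentiable_iff:
  "continuous_part q differentiable (at x) \<longleftrightarrow> x \<in> smooth_points q"
proof -
  consider "q = 1" | "q = 2" | "q = 3" | "q = 4" | "q = 5" | "q = 6" | "q \<notin> {1, 2, 3, 4, 5, 6}"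
    by blast
  then show ?thesis
  proof cases
    case 1
    then show ?thesis
      by (simp add: continuous_part_def[abs_def] smooth_points_def takagi_not_differentiable)
  next
    case 2
    have "((\<lambda>x. x + 1 / 2) has_real_derivative 1) (at x)" by (auto intro!: derivative_eq_intros)
    from differentiable_times_takagi_iff[OF this] show ?thesis
      using 2 by (auto simp: continuous_part_def[abs_def] smooth_points_def)
  next
    case 3
    have "((\<lambda>x. cos (pi * x)) has_real_derivative - pi * sin (pi * x)) (at x)"
      by (auto intro!: derivative_eq_intros)
    from differentiable_times_takagi_iff[OF this] show ?thesis
      using 3 by (simp add: continuous_part_def[abs_def] smooth_points_def cos_pi_times_eq_0_iff)
  next
    case 4
    then show ?thesis
      by (simp add: continuous_part_def[abs_def] smooth_points_def
          positive_part_times_takagi_differentiable_iff)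
  next
    case 5
    then show ?thesis
      using differentiable_abs_iff[OF has_real_derivative_sin_pi, of x] cos_pi_times_neq_0[of x]
      by (auto simp: continuous_part_def[abs_def] smooth_points_def sin_pi_times_eq_0_iff)
  next
    case 6
    then show ?thesis using differentiable_abs_iff[OF DERIV_ident, of x]
      by (simp add: continuous_part_def[abs_def] smooth_points_def)
  next
    case 7
    then have "continuous_part q = (\<lambda>_. 0)" "smooth_points q = UNIV"
      by (auto simp: continuous_part_def smooth_points_def)
    then show ?thesis by simp
  qed
qed

section \<open>The representatives with an uncountable set of continuity points\<close>

lemma isCont_add_iff:
  fixes g h :: "real \<Rightarrow> real"
  assumes "isCont h x"
  shows "isCont (\<lambda>x. g x + h x) x \<longleftrightarrow> isCont g x"
proof
  assume "isCont (\<lambda>x. g x + h x) x"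
  from isCont_diff[OF this assms] show "isCont g x" by simp
qed (simp add: assms)

lemma differentiable_add_iff:
  fixes g h :: "real \<Rightarrow> real"
  assumes "g differentiable (at x)"
  shows "(\<lambda>x. g x + h x) differentiable (at x) \<longleftrightarrow> h differentiable (at x)"
proof
  assume "(\<lambda>x. g x + h x) differentiable (at x)"
  from differentiable_diff[OF this assms] show "h differentiable (at x)" by simp
qed (simp add: assms)

text \<open>Adding a continuous function does not change where the jump part is continuous. At a jump the
  sum is therefore not differentiable; elsewhere the jump part is differentiable and only the
  continuous part matters.\<close>
lemma representative_sets_ge_4:
  assumes "4 \<le> p"
  shows "continuity_set (representative p q) = - jumps p"
    and "differentiability_set (representative p q) = smooth_points q - jumps p"
proof -
  have rep: "representative p q = (\<lambda>x. jump_part p x + continuous_part q x)"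
    using assms by (auto simp: representative_def)
  have cont: "isCont (representative p q) x \<longleftrightarrow> x \<notin> jumps p" for x
    unfolding rep isCont_add_iff[OF isCont_continuous_part]
    using jump_part_discontinuous jump_part_derivative DERIV_isCont by blast
  then show "continuity_set (representative p q) = - jumps p" by (auto simp: continuity_set_def)
  have "representative p q differentiable (at x) \<longleftrightarrow> x \<in> smooth_points q - jumps p" for x
  proof (cases "x \<in> jumps p")
    case True
    then show ?thesis using cont differentiable_imp_continuous_within by blast
  next
    case False
    then have "jump_part p differentiable (at x)"
      using jump_part_derivative real_differentiable_def by blast
    from differentiable_add_iff[OF this] show ?thesis
      unfolding rep using False by (simp add: continuous_part_differentiable_iff)
  qed
  then show "differentiability_set (representative p q) = smooth_points q - jumps p"
    by (auto simp: differentiability_set_def)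
qed

lemma has_level_jumps_compl:
  assumes "4 \<le> p" "p \<le> 7"
  shows "has_level (- jumps p) p"
proof -
  have "p = 4 \<or> p = 5 \<or> p = 6 \<or> p = 7" using assms by presburger
  then consider "p = 4" | "p = 5" | "p = 6" | "p = 7" by blast
  then show ?thesis
  proof cases
    case 1
    have "uncountable (- {0::real..})" by (rule uncountable_if_open_interval[of "-1" 0]) auto
    moreover have "uncountable {0::real..}" by (rule uncountable_if_open_interval[of 0 1]) auto
    ultimately show ?thesis using has_level_4[of "- {0..}"] 1 by (simp add: jumps_def)
  next
    case 2
    then show ?thesis using has_level_compl[OF has_level_3[OF countable_Ints infinite_Ints]]
      by (simp add: jumps_def)
  next
    case 3
    then show ?thesis using has_level_compl[OF has_level_2[of "{0}"]] by (simp add: jumps_def)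
  next
    case 4
    then show ?thesis using has_level_compl[OF has_level_1] by (simp add: jumps_def)
  qed
qed

lemma half_integer_not_Ints: "of_int k + 1 / 2 \<notin> (\<int> :: real set)"
proof
  assume "of_int k + 1 / 2 \<in> (\<int> :: real set)"
  then obtain m where "of_int k + 1 / 2 = (of_int m :: real)" by (auto elim: Ints_cases)
  then have "of_int (2 * k + 1) = (of_int (2 * m) :: real)" by simp
  then have "2 * k + 1 = 2 * m" by linarith
  then show False by presburger
qed

lemma jumps_subset: "jumps p \<subseteq> {0..} \<union> \<int>"
  by (auto simp: jumps_def)

text \<open>Removing the jumps does not lower the level: for \<open>q \<le> 4\<close> the negative half-integers and the
  interval from \<open>-1\<close> to \<open>0\<close> avoid every possible jump, and for \<open>q \<ge> 5\<close> the jumps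
  already lie among the kinks of the continuous part, because \<open>q \<le> p\<close>.\<close>
lemma has_level_smooth_points_diff_jumps:
  assumes "1 \<le> q" "q \<le> p" "4 \<le> p" "p \<le> 7"
  shows "has_level (smooth_points q - jumps p) q"
proof -
  have neg_half: "of_int k + 1 / 2 \<notin> jumps p" if "k < 0" for k
  proof -
    have "of_int k \<le> (-1 :: real)" using that by linarith
    then show ?thesis using jumps_subset[of p] half_integer_not_Ints[of k] by auto
  qed
  have "q = 1 \<or> q = 2 \<or> q = 3 \<or> q = 4 \<or> q = 5 \<or> q = 6 \<or> q = 7" using assms by presburger
  then consider "q = 1" | "q = 2" | "q = 3" | "q = 4" | "q \<in> {5, 6, 7}" by blast
  then show ?thesis
  proof cases
    case 1
    then show ?thesis using has_level_1 by (simp add: smooth_points_def)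
  next
    case 2
    then have "smooth_points q - jumps p = {- 1 / 2}"
      using neg_half[of "-1"] by (auto simp: smooth_points_def)
    then show ?thesis using has_level_2[of "{- 1 / 2}"] 2 by simp
  next
    case 3
    have "infinite ((\<lambda>k::int. of_int k + 1 / 2 :: real) ` {..<0})"
      by (subst finite_image_iff) (auto simp: inj_on_def infinite_Iio)
    moreover have "(\<lambda>k::int. of_int k + 1 / 2) ` {..<0} \<subseteq> smooth_points q - jumps p"
      using neg_half 3 by (auto simp: smooth_points_def)
    ultimately have "infinite (smooth_points q - jumps p)" using finite_subset by blast
    moreover have "countable (smooth_points q - jumps p)" using 3 by (simp add: smooth_points_def)
    ultimately show ?thesis using has_level_3 3 by blast
  next
    case 4
    have "x \<notin> jumps p" if "x \<in> {-1<..<0}" for x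
    proof -
      have "\<lfloor>x\<rfloor> = -1" using that by (simp add: floor_eq_iff)
      then have "x \<notin> \<int>" using that by (auto elim!: Ints_cases)
      then show ?thesis using jumps_subset[of p] that by auto
    qed
    then have "{-1<..<0} \<subseteq> smooth_points q - jumps p" using 4 by (auto simp: smooth_points_def)
    then have "uncountable (smooth_points q - jumps p)"
      by (rule uncountable_if_open_interval) simp
    moreover have "{0<..<1} \<subseteq> - (smooth_points q - jumps p)" using 4 by (auto simp: smooth_points_def)
    then have "uncountable (- (smooth_points q - jumps p))"
      by (rule uncountable_if_open_interval) simp
    ultimately have "has_level (smooth_points q - jumps p) 4" by (rule has_level_4)
    then show ?thesis using 4 by simp
  next
    case 5
    then have "smooth_points q - jumps p = - jumps q"
      using assms by (auto simp: smooth_points_def jumps_def)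
    then show ?thesis using has_level_jumps_compl[of q] 5 by auto
  qed
qed

section \<open>The representatives with a countable set of continuity points\<close>

lemma times_dirichlet_sets:
  assumes "\<And>x. (s has_real_derivative D x) (at x)"
  shows "continuity_set (\<lambda>x. s x * dirichlet x) = {x. s x = 0}"
    and "differentiability_set (\<lambda>x. s x * dirichlet x) = {x. s x = 0 \<and> D x = 0}"
  using isCont_times_dirichlet_iff[OF DERIV_isCont[OF assms]]
    differentiable_times_dirichlet_iff[OF assms]
  by (simp_all add: continuity_set_def differentiability_set_def)

lemma has_level_representative_le_3:
  assumes "1 \<le> q" "q \<le> p" "p \<le> 3"
  shows "has_level (continuity_set (representative p q)) p
    \<and> has_level (differentiability_set (representative p q)) q"
proof -
  have rep: "representative p q = (\<lambda>x. smooth_factor p q x * dirichlet x)"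
    using assms by (auto simp: representative_def)
  note zero = has_level_2[of "{0}", simplified]
  note ints = has_level_3[OF countable_Ints infinite_Ints]
  have "p = 1 \<and> q = 1 \<or> p = 2 \<and> q = 1 \<or> p = 2 \<and> q = 2
    \<or> p = 3 \<and> q = 1 \<or> p = 3 \<and> q = 2 \<or> p = 3 \<and> q = 3"
    using assms by presburger
  then consider "p = 1" "q = 1" | "p = 2" "q = 1" | "p = 2" "q = 2"
    | "p = 3" "q = 1" | "p = 3" "q = 2" | "p = 3" "q = 3"
    by blast
  then show ?thesis
  proof cases
    case 1
    have "((\<lambda>x. 1) has_real_derivative 0) (at x)" for x by simp
    from times_dirichlet_sets[OF this] show ?thesis
      unfolding rep using 1 has_level_1 by (simp add: smooth_factor_def)
  next
    case 2
    have "((\<lambda>x. x) has_real_derivative 1) (at x)" for x by simp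
    from times_dirichlet_sets[OF this] show ?thesis
      unfolding rep using 2 has_level_1 zero by (simp add: smooth_factor_def)
  next
    case 3
    have "((\<lambda>x. x ^ 2) has_real_derivative 2 * x) (at x)" for x
      by (auto intro!: derivative_eq_intros)
    from times_dirichlet_sets[OF this] show ?thesis
      unfolding rep using 3 zero by (simp add: smooth_factor_def)
  next
    case 4
    have "{x \<in> \<int>. cos (pi * x) = 0} = {}"
      using cos_pi_times_neq_0 by auto
    with times_dirichlet_sets[OF has_real_derivative_sin_pi] show ?thesis
      unfolding rep using 4 has_level_1 ints by (simp add: smooth_factor_def sin_pi_times_eq_0_iff)
  next
    case 5
    have "((\<lambda>x. x * sin (pi * x)) has_real_derivative sin (pi * x) + pi * x * cos (pi * x)) (at x)" for x
      by (auto intro!: derivative_eq_intros)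
    note sets = times_dirichlet_sets[OF this]
    have "{x. x * sin (pi * x) = 0} = \<int>" by (auto simp: sin_pi_times_eq_0_iff)
    moreover have "x = 0" if "x \<in> \<int>" "sin (pi * x) + pi * x * cos (pi * x) = 0" for x
    proof -
      have "sin (pi * x) = 0" using that(1) by (simp only: sin_pi_times_eq_0_iff)
      then have "pi * x * cos (pi * x) = 0" using that(2) by linarith
      then show ?thesis using cos_pi_times_neq_0[OF that(1)] by simp
    qed
    then have "{x. x * sin (pi * x) = 0 \<and> sin (pi * x) + pi * x * cos (pi * x) = 0} = {0}"
      by (auto simp: sin_pi_times_eq_0_iff)
    ultimately show ?thesis
      unfolding rep using sets 5 zero ints by (simp add: smooth_factor_def)
  next
    case 6
    have "((\<lambda>x. sin (pi * x) ^ 2) has_real_derivative 2 * sin (pi * x) * (pi * cos (pi * x))) (at x)" for x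
      by (auto intro!: derivative_eq_intros)
    note sets = times_dirichlet_sets[OF this]
    have "{x. sin (pi * x) ^ 2 = 0} = \<int>"
      "{x. sin (pi * x) ^ 2 = 0 \<and> 2 * sin (pi * x) * (pi * cos (pi * x)) = 0} = \<int>"
      by (auto simp: sin_pi_times_eq_0_iff)
    then show ?thesis
      unfolding rep using sets 6 ints by (simp add: smooth_factor_def)
  qed
qed

section \<open>The blocks\<close>

lemma has_level_representative:
  assumes "1 \<le> q" "q \<le> p" "p \<le> 7"
  shows "has_level (continuity_set (representative p q)) p"
    and "has_level (differentiability_set (representative p q)) q"
proof -
  have "has_level (continuity_set (representative p q)) p
    \<and> has_level (differentiability_set (representative p q)) q"
  proof (cases "p \<le> 3")
    case True
    then show ?thesis using has_level_representative_le_3 assms by simp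
  next
    case False
    then have "4 \<le> p" by simp
    then show ?thesis
      using assms has_level_jumps_compl has_level_smooth_points_diff_jumps
      by (simp add: representative_sets_ge_4)
  qed
  then show "has_level (continuity_set (representative p q)) p"
    "has_level (differentiability_set (representative p q)) q" by auto
qed

lemma representative_in_block:
  assumes "1 \<le> q" "q \<le> p" "p \<le> 7"
  shows "representative p q \<in> block (block_index p q)"
  using assms has_level_representative[OF assms] unfolding block_def by blast

lemma block_index_unique:
  assumes "f \<in> block i" "f \<in> block j"
  shows "i = j"
  using assms has_level_unique unfolding block_def by blast

lemma block_index_bounds:
  assumes "1 \<le> q" "q \<le> p"
  shows "p * (p - 1) div 2 < block_index p q" "block_index p q \<le> Suc p * p div 2"
proof -
  have "Suc p * p = p * (p - 1) + 2 * p" by (cases p) (auto simp: algebra_simps)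
  then have "Suc p * p div 2 = p * (p - 1) div 2 + p" by simp
  then show "p * (p - 1) div 2 < block_index p q" "block_index p q \<le> Suc p * p div 2"
    using assms by (simp_all add: block_index_def)
qed

lemma block_index_less:
  assumes "1 \<le> q" "q \<le> p" "1 \<le> q'" "q' \<le> p'" "p < p'"
  shows "block_index p q < block_index p' q'"
proof -
  have "Suc p * p div 2 \<le> p' * (p' - 1) div 2"
    using assms by (intro div_le_mono mult_le_mono) auto
  then show ?thesis using block_index_bounds[of q p] block_index_bounds[of q' p'] assms by linarith
qed

text \<open>The indices with first component \<open>p\<close> fill the gap between consecutive triangular numbers, so
  distinct pairs have distinct indices, and counting the pairs shows that nothing is left out.\<close>
lemma bij_betw_block_index:
  "bij_betw (\<lambda>(p, q). block_index p q) {(p, q). 1 \<le> q \<and> q \<le> p \<and> p \<le> 7} {1..28}"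
    (is "bij_betw ?f ?A _")
proof -
  have A: "?A = (SIGMA p:{1..7}. {1..p})" by auto
  have inj: "inj_on ?f ?A"
  proof (rule inj_onI, clarify)
    fix p q p' q' :: nat
    assume ord: "1 \<le> q" "q \<le> p" "1 \<le> q'" "q' \<le> p'" and eq: "block_index p q = block_index p' q'"
    have "p = p'" using block_index_less[OF ord] block_index_less[OF ord(3,4,1,2)] eq
      by (metis less_irrefl linorder_neqE_nat)
    then show "p = p' \<and> q = q'" using eq by (simp add: block_index_def)
  qed
  have "?f ` ?A \<subseteq> {1..28}"
  proof clarify
    fix p q :: nat assume "1 \<le> q" "q \<le> p" "p \<le> 7"
    then have "block_index p q \<le> Suc p * p div 2" "1 \<le> block_index p q"
      using block_index_bounds[of q p] by auto
    moreover have "Suc p * p div 2 \<le> 8 * 7 div 2"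
      using \<open>p \<le> 7\<close> by (intro div_le_mono mult_le_mono) auto
    ultimately show "block_index p q \<in> {1..28}" by simp
  qed
  moreover have "card (?f ` ?A) = card {1..28::nat}"
  proof -
    have "card (?f ` ?A) = card ?A" by (rule card_image[OF inj])
    also have "\<dots> = (\<Sum>p\<in>{1..7}. p)" unfolding A by simp
    also have "\<dots> = card {1..28::nat}" by (simp add: numeral_eq_Suc)
    finally show ?thesis .
  qed
  ultimately have "?f ` ?A = {1..28}" by (intro card_subset_eq) auto
  with inj show ?thesis by (simp add: bij_betw_def)
qed

theorem theorem3p3:
  shows "bij_betw (\<lambda>(p, q). block_index p q) {(p, q). 1 \<le> q \<and> q \<le> p \<and> p \<le> 7} {1..28} \<and>
    inj_on block {1..28} \<and>
    (\<forall>p q. 1 \<le> q \<and> q \<le> p \<and> p \<le> 7 \<longrightarrow>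
       representative p q \<in> block (block_index p q) \<and>
       has_level (continuity_set (representative p q)) p \<and>
       has_level (differentiability_set (representative p q)) q)"
proof (intro conjI allI impI)
  show "inj_on block {1..28}"
  proof (rule inj_onI)
    fix i j :: nat assume "i \<in> {1..28}" and same: "block i = block j"
    then have "i \<in> (\<lambda>(p, q). block_index p q) ` {(p, q). 1 \<le> q \<and> q \<le> p \<and> p \<le> 7}"
      by (simp only: bij_betw_imp_surj_on[OF bij_betw_block_index])
    then obtain p q where "1 \<le> q" "q \<le> p" "p \<le> 7" "i = block_index p q" by auto
    then have "representative p q \<in> block i" using representative_in_block by simp
    then show "i = j" using same block_index_unique by blast
  qed
qed (use bij_betw_block_index in simp, simp_all only: representative_in_block has_level_representative)

end
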